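(* Suppose that $(\Gamma,\alpha)$ is an abstract 1-skeleton of type $(k,n)$ such that $\alpha$ is $l$-independent, where $l\le k$. Then for faces $F^{m_1},\dots,F^{m_s}$ of dimension less than $l$ in $(\Gamma,\alpha)$ with $s>1$, their intersection $F^{m_1}\cap\cdots\cap F^{m_s}$ is either empty or the disjoint union of lower-dimensional faces.
   Context: Let $G=(\mathbb{Z}_2)^k$, $k\ge1$. $\mathrm{Hom}(G,\mathbb{Z}_2)$ is regarded as a $k$-dimensional vector space over $\mathbb{Z}_2$ with zero element $\rho_0$. An abstract 1-skeleton of type $(k,n)$ (with $n\ge k$) is a pair $(\Gamma,\alpha)$ where $\Gamma$ is a finite $n$-valent regular graph without loops, with vertex set $V_\Gamma$ and edge set $E_\Gamma$, and $\alpha:E_\Gamma\to\mathrm{Hom}(G,\mathbb{Z}_2)\setminus\{\rho_0\}$ is a map such that, with $E_p$ the set of edges adjacent to the vertex $p$ and $\alpha(E_p)$ the collection of values of $\alpha$ on $E_p$ (counted with multiplicity): (1) for each $p\in V_\Gamma$, $\alpha(E_p)$ spans $\mathrm{Hom}(G,\mathbb{Z}_2)$; (2) for each edge $e$ with endpoints $p,q$, $\alpha(E_p)\equiv\alpha(E_q)\bmod\alpha(e)$. $\alpha$ is $l$-independent if for each vertex $p\in V_\Gamma$ any $l$ elements of $\alpha(E_p)$ are linearly independent in $\mathrm{Hom}(G,\mathbb{Z}_2)$. For $0\le\ell\le n$, an $\ell$-dimensional face ($\ell$-face) of $(\Gamma,\alpha)$ is a pair $(\Gamma',\alpha|_{\Gamma'})$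 with $\Gamma'$ a connected $\ell$-valent subgraph of $\Gamma$ for which there is a subspace $K$ of $\mathrm{Hom}(G,\mathbb{Z}_2)$ such that (writing $E_p|_{\Gamma'}$ for the edges of $\Gamma'$ adjacent to $p$) (1) for each vertex $p\in V_{\Gamma'}$, $\alpha(E_p|_{\Gamma'})$ spans $K$, and (2) for each edge $e=pq$ of $\Gamma'$, $\alpha(E_p|_{\Gamma'})\equiv\alpha(E_q|_{\Gamma'})\bmod\alpha(e)$. Each vertex of $\Gamma$ is a $0$-face. $F^{m_i}$ denotes a face of dimension $m_i$. Intersections of faces are intersections of subgraphs.
   Formalization: "Lower-dimensional" fails for repeated or nested faces. Proved instead: each component has dimension less than m_i for every i unless it equals F^{m_i} itself, and, if the faces are not all the same, dimension less than some m_i. *)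

theory Defs
  imports
    "HOL-Analysis.Finite_Cartesian_Product"
    "HOL-Library.Z2"
    "HOL-Library.Function_Algebras"
    "HOL-Library.Multiset"
begin

text \<open>
  The group $G = (\mathbb{Z}_2)^k$ is the type \<open>bit ^ 'k\<close>, written additively, with
  $k$ the cardinality of \<open>'k\<close>. The homomorphisms $G \to \mathbb{Z}_2$ live in the
  $\mathbb{Z}_2$-vector space of all functions $G \to \mathbb{Z}_2$ with pointwise operations.
\<close>

definition bit_scale :: "bit \<Rightarrow> ('a \<Rightarrow> bit) \<Rightarrow> 'a \<Rightarrow> bit" where
  "bit_scale c \<rho> = (\<lambda>g. c * \<rho> g)"

global_interpretation bitfun: vector_space "bit_scale :: bit \<Rightarrow> ('a \<Rightarrow> bit) \<Rightarrow> 'a \<Rightarrow> bit"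
  by unfold_locales
    (simp_all only: bit_scale_def plus_fun_def fun_eq_iff distrib_left distrib_right
      mult.assoc mult_1_left simp_thms)

definition Hom_Z2 :: "(bit ^ 'k \<Rightarrow> bit) set" where
  "Hom_Z2 = {\<rho>. additive \<rho>}"

text \<open>
  Congruence modulo \<open>v\<close> of two finite collections with multiplicity: their images in the
  quotient by the line spanned by \<open>v\<close> agree as multisets.
\<close>

definition quot_class :: "('a \<Rightarrow> bit) \<Rightarrow> ('a \<Rightarrow> bit) \<Rightarrow> ('a \<Rightarrow> bit) set" where
  "quot_class v x = {x + w | w. w \<in> bitfun.span {v}}"

definition cong_modulo ::
    "('a \<Rightarrow> bit) multiset \<Rightarrow> ('a \<Rightarrow> bit) multiset \<Rightarrow> ('a \<Rightarrow> bit) \<Rightarrow> bool" where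
  "cong_modulo A B v \<longleftrightarrow> image_mset (quot_class v) A = image_mset (quot_class v) B"

text \<open>
  Graphs may have multiple edges but no loops; \<open>ends e\<close> is the set of the two endpoints of \<open>e\<close>.
\<close>

record ('v, 'e) multigraph =
  verts :: "'v set"
  edges :: "'e set"
  ends :: "'e \<Rightarrow> 'v set"

definition finite_loopless_graph :: "('v, 'e) multigraph \<Rightarrow> bool" where
  "finite_loopless_graph \<Gamma> \<longleftrightarrow> finite (verts \<Gamma>) \<and> finite (edges \<Gamma>) \<and>
     (\<forall>e\<in>edges \<Gamma>. ends \<Gamma> e \<subseteq> verts \<Gamma> \<and> card (ends \<Gamma> e) = 2)"

definition edges_at :: "('v, 'e) multigraph \<Rightarrow> 'v \<Rightarrow> 'e set" where
  "edges_at \<Gamma> p = {e \<in> edges \<Gamma>. p \<in> ends \<Gamma> e}"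

definition regular :: "nat \<Rightarrow> ('v, 'e) multigraph \<Rightarrow> bool" where
  "regular n \<Gamma> \<longleftrightarrow> (\<forall>p\<in>verts \<Gamma>. card (edges_at \<Gamma> p) = n)"

definition adjacent :: "('v, 'e) multigraph \<Rightarrow> 'v \<Rightarrow> 'v \<Rightarrow> bool" where
  "adjacent \<Gamma> p q \<longleftrightarrow> (\<exists>e\<in>edges \<Gamma>. ends \<Gamma> e = {p, q})"

text \<open>A connected graph is nonempty by convention.\<close>

definition connected_graph :: "('v, 'e) multigraph \<Rightarrow> bool" where
  "connected_graph \<Gamma> \<longleftrightarrow> verts \<Gamma> \<noteq> {} \<and> (\<forall>p\<in>verts \<Gamma>. \<forall>q\<in>verts \<Gamma>. (adjacent \<Gamma>)\<^sup>*\<^sup>* p q)"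

text \<open>
  A subgraph keeps the (total) endpoint function of the ambient graph, so that two subgraphs are
  equal iff they have the same vertices and the same edges.
\<close>

definition subgraph :: "('v, 'e) multigraph \<Rightarrow> ('v, 'e) multigraph \<Rightarrow> bool" where
  "subgraph H \<Gamma> \<longleftrightarrow> verts H \<subseteq> verts \<Gamma> \<and> edges H \<subseteq> edges \<Gamma> \<and> ends H = ends \<Gamma> \<and>
     (\<forall>e\<in>edges H. ends H e \<subseteq> verts H)"

definition inter_graph ::
    "('v, 'e) multigraph \<Rightarrow> 'i set \<Rightarrow> ('i \<Rightarrow> ('v, 'e) multigraph) \<Rightarrow> ('v, 'e) multigraph" where
  "inter_graph \<Gamma> I F =
     \<lparr>verts = (\<Inter>i\<in>I. verts (F i)), edges = (\<Inter>i\<in>I. edges (F i)), ends = ends \<Gamma>\<rparr>"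

definition is_disjoint_union ::
    "('v, 'e) multigraph \<Rightarrow> ('v, 'e) multigraph set \<Rightarrow> bool" where
  "is_disjoint_union G \<H> \<longleftrightarrow>
     verts G = (\<Union>H\<in>\<H>. verts H) \<and> edges G = (\<Union>H\<in>\<H>. edges H) \<and>
     (\<forall>H\<in>\<H>. \<forall>H'\<in>\<H>. H \<noteq> H' \<longrightarrow> verts H \<inter> verts H' = {} \<and> edges H \<inter> edges H' = {})"

text \<open>The collection $\alpha(E_p)$, counted with multiplicity.\<close>

definition labels_at ::
    "('e \<Rightarrow> 'a \<Rightarrow> bit) \<Rightarrow> ('v, 'e) multigraph \<Rightarrow> 'v \<Rightarrow> ('a \<Rightarrow> bit) multiset" where
  "labels_at \<alpha> \<Gamma> p = image_mset \<alpha> (mset_set (edges_at \<Gamma> p))"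

definition congruent_along_edges ::
    "('v, 'e) multigraph \<Rightarrow> ('e \<Rightarrow> 'a \<Rightarrow> bit) \<Rightarrow> bool" where
  "congruent_along_edges \<Gamma> \<alpha> \<longleftrightarrow>
     (\<forall>e\<in>edges \<Gamma>. \<forall>p q. ends \<Gamma> e = {p, q} \<longrightarrow>
        cong_modulo (labels_at \<alpha> \<Gamma> p) (labels_at \<alpha> \<Gamma> q) (\<alpha> e))"

text \<open>
  Type $(k, n)$, where $k$ is read off from the type of \<open>\<alpha>\<close>.
\<close>

definition abstract_1_skeleton ::
    "nat \<Rightarrow> ('v, 'e) multigraph \<Rightarrow> ('e \<Rightarrow> bit ^ 'k \<Rightarrow> bit) \<Rightarrow> bool" where
  "abstract_1_skeleton n \<Gamma> \<alpha> \<longleftrightarrow>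
     CARD('k) \<le> n \<and> finite_loopless_graph \<Gamma> \<and> regular n \<Gamma> \<and>
     \<alpha> ` edges \<Gamma> \<subseteq> Hom_Z2 - {0} \<and>
     (\<forall>p\<in>verts \<Gamma>. bitfun.span (set_mset (labels_at \<alpha> \<Gamma> p)) = Hom_Z2) \<and>
     congruent_along_edges \<Gamma> \<alpha>"

text \<open>
  Independence is that of a family indexed by edges: a value occurring on two of the chosen
  edges counts as a dependence.
\<close>

definition l_independent ::
    "nat \<Rightarrow> ('v, 'e) multigraph \<Rightarrow> ('e \<Rightarrow> bit ^ 'k \<Rightarrow> bit) \<Rightarrow> bool" where
  "l_independent l \<Gamma> \<alpha> \<longleftrightarrow>
     (\<forall>p\<in>verts \<Gamma>. \<forall>T \<subseteq> edges_at \<Gamma> p. card T = l \<longrightarrow>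
        inj_on \<alpha> T \<and> bitfun.independent (\<alpha> ` T))"

text \<open>
  The bound $d \le n$ on the dimension of a face is automatic, because a nonempty $d$-valent
  subgraph of an $n$-valent graph has $d \le n$.
\<close>

definition is_face ::
    "('v, 'e) multigraph \<Rightarrow> ('e \<Rightarrow> bit ^ 'k \<Rightarrow> bit) \<Rightarrow> nat \<Rightarrow> ('v, 'e) multigraph \<Rightarrow> bool" where
  "is_face \<Gamma> \<alpha> d H \<longleftrightarrow>
     subgraph H \<Gamma> \<and> connected_graph H \<and> regular d H \<and>
     (\<exists>K. bitfun.subspace K \<and> K \<subseteq> Hom_Z2 \<and>
        (\<forall>p\<in>verts H. bitfun.span (set_mset (labels_at \<alpha> H p)) = K)) \<and>
     congruent_along_edges H \<alpha>"

end

theory Submission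
  imports Defs
begin

text \<open>
  By \<open>l\<close>-independence, a face of dimension less than \<open>l\<close> with label space \<open>K\<close> contains every
  edge of \<open>\<Gamma>\<close> at one of its vertices whose label lies in \<open>K\<close>. So at each of its vertices the
  intersection consists of the edges labelled in \<open>\<Inter>\<^sub>i K\<^sub>i\<close>. Membership in a subspace is
  unaffected by passing to the quotient by one of its own vectors, so the congruence of \<open>\<Gamma>\<close> along
  an edge of the intersection restricts to these labels. Valency and span of labels are therefore
  constant on each component. If a component has the same valency as \<open>F\<^sub>i\<close>, it exhausts
  \<open>F\<^sub>i\<close> by connectedness.
\<close>

section \<open>Congruence of label collections, subspaces and spans\<close>

lemma quot_class_self: "x \<in> quot_class v x"
  unfolding quot_class_def using bitfun.span_zero[of "{v}"] by force

text \<open>The class of \<open>x\<close> is a coset of the line through \<open>v\<close>, and this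
  line lies in \<open>K\<close>. Membership in \<open>K\<close> thus becomes a property of the class
  alone, which is all that a congruence modulo \<open>v\<close> can see.\<close>

lemma quot_class_subset_subspace_iff:
  assumes "bitfun.subspace K" "v \<in> K"
  shows "quot_class v x \<subseteq> K \<longleftrightarrow> x \<in> K"
proof
  assume "quot_class v x \<subseteq> K"
  then show "x \<in> K" using quot_class_self[of x v] by blast
next
  assume "x \<in> K"
  moreover have "bitfun.span {v} \<subseteq> K"
    using assms by (intro bitfun.span_minimal) auto
  ultimately show "quot_class v x \<subseteq> K"
    unfolding quot_class_def using bitfun.subspace_add[OF assms(1)] by blast
qed

lemma cong_modulo_sym: "cong_modulo A B v \<Longrightarrow> cong_modulo B A v"
  by (simp add: cong_modulo_def)

lemma cong_modulo_size_eq: "cong_modulo A B v \<Longrightarrow> size A = size B"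
  unfolding cong_modulo_def by (metis size_image_mset)

text \<open>Selecting elements by membership in \<open>K\<close> before taking classes is the same
  as selecting classes by inclusion in \<open>K\<close> afterwards, and the classes of
  \<open>A\<close> and \<open>B\<close> agree.\<close>

lemma cong_modulo_filter_subspace:
  assumes "cong_modulo A B v" "bitfun.subspace K" "v \<in> K"
  shows "cong_modulo (filter_mset (\<lambda>x. x \<in> K) A) (filter_mset (\<lambda>x. x \<in> K) B) v"
proof -
  have "image_mset (quot_class v) (filter_mset (\<lambda>x. x \<in> K) C)
      = filter_mset (\<lambda>Q. Q \<subseteq> K) (image_mset (quot_class v) C)" for C
    by (simp add: filter_mset_image_mset quot_class_subset_subspace_iff[OF assms(2,3)])
  then show ?thesis using assms(1) by (simp add: cong_modulo_def)
qed

text \<open>Each element of \<open>A\<close> differs from some element of \<open>B\<close> by a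
  multiple of \<open>v\<close>, and \<open>v\<close> itself occurs in \<open>B\<close>.\<close>

lemma cong_modulo_span_subset:
  assumes "cong_modulo A B v" "v \<in># B"
  shows "bitfun.span (set_mset A) \<subseteq> bitfun.span (set_mset B)"
proof (intro bitfun.span_minimal bitfun.subspace_span subsetI)
  fix a assume "a \<in># A"
  then have "quot_class v a \<in># image_mset (quot_class v) B"
    using assms(1) unfolding cong_modulo_def by (metis image_eqI set_image_mset)
  then obtain b where b: "b \<in># B" "quot_class v a = quot_class v b" by auto
  then obtain w where w: "a = b + w" "w \<in> bitfun.span {v}"
    using quot_class_self[of a v] unfolding quot_class_def by auto
  have "bitfun.span {v} \<subseteq> bitfun.span (set_mset B)"
    using assms(2) by (intro bitfun.span_mono) auto
  then show "a \<in> bitfun.span (set_mset B)"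
    using w b(1) by (auto intro: bitfun.span_add bitfun.span_base)
qed

lemma cong_modulo_span_eq:
  assumes "cong_modulo A B v" "v \<in># A" "v \<in># B"
  shows "bitfun.span (set_mset A) = bitfun.span (set_mset B)"
  using assms cong_modulo_span_subset cong_modulo_sym by blast

section \<open>Subgraphs, intersections and edges at a vertex\<close>

lemma finite_edges_at: "finite_loopless_graph \<Gamma> \<Longrightarrow> finite (edges_at \<Gamma> p)"
  by (simp add: finite_loopless_graph_def edges_at_def)

lemma finite_loopless_subgraph:
  assumes "subgraph H \<Gamma>" "finite_loopless_graph \<Gamma>"
  shows "finite_loopless_graph H"
  using assms unfolding subgraph_def finite_loopless_graph_def
  by (auto intro: finite_subset) (metis subsetD)+

lemma subgraph_trans: "subgraph H G \<Longrightarrow> subgraph G \<Gamma> \<Longrightarrow> subgraph H \<Gamma>"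
  unfolding subgraph_def by (metis subset_trans)

lemma subgraph_edges_at_subset: "subgraph H G \<Longrightarrow> edges_at H p \<subseteq> edges_at G p"
  by (auto simp: subgraph_def edges_at_def)

text \<open>Nonemptiness of \<open>I\<close> matters: an intersection over the empty index set is
  the whole type, which need not lie in \<Gamma>.\<close>

lemma subgraph_inter_graph:
  assumes "\<And>i. i \<in> I \<Longrightarrow> subgraph (F i) \<Gamma>" "I \<noteq> {}"
  shows "subgraph (inter_graph \<Gamma> I F) \<Gamma>"
proof -
  obtain j where "j \<in> I" using assms(2) by blast
  have "ends \<Gamma> e \<subseteq> verts (F i)" if "i \<in> I" "e \<in> edges (F i)" for e i
    using assms(1)[OF that(1)] that(2) by (metis subgraph_def)
  then have "\<forall>e\<in>\<Inter>i\<in>I. edges (F i). ends \<Gamma> e \<subseteq> (\<Inter>i\<in>I. verts (F i))"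
    by (simp add: INT_greatest)
  moreover have "(\<Inter>i\<in>I. verts (F i)) \<subseteq> verts \<Gamma>" "(\<Inter>i\<in>I. edges (F i)) \<subseteq> edges \<Gamma>"
    using assms(1)[OF \<open>j \<in> I\<close>] INF_lower[OF \<open>j \<in> I\<close>, of "\<lambda>i. verts (F i)"]
      INF_lower[OF \<open>j \<in> I\<close>, of "\<lambda>i. edges (F i)"]
    unfolding subgraph_def by (meson subset_trans)+
  ultimately show ?thesis by (simp add: subgraph_def inter_graph_def)
qed

lemma edges_at_inter_graph:
  assumes "\<And>i. i \<in> I \<Longrightarrow> subgraph (F i) \<Gamma>" "I \<noteq> {}"
  shows "edges_at (inter_graph \<Gamma> I F) p = (\<Inter>i\<in>I. edges_at (F i) p)"
  using assms unfolding subgraph_def inter_graph_def edges_at_def by auto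

lemma ends_eq_doubleton:
  assumes "finite_loopless_graph G" "e \<in> edges_at G p"
  obtains q where "ends G e = {p, q}"
proof -
  have "card (ends G e) = 2" "p \<in> ends G e"
    using assms by (auto simp: finite_loopless_graph_def edges_at_def)
  then show ?thesis using that by (auto simp: card_2_iff doubleton_eq_iff)
qed

lemma set_labels_at:
  "finite_loopless_graph G \<Longrightarrow> set_mset (labels_at \<alpha> G p) = \<alpha> ` edges_at G p"
  by (simp add: labels_at_def finite_edges_at)

section \<open>Connectedness and connected components\<close>

lemma adjacent_reachable_sym:
  assumes "(adjacent G)\<^sup>*\<^sup>* p q"
  shows "(adjacent G)\<^sup>*\<^sup>* q p"
proof -
  have "symp (adjacent G)"
    by (auto simp: symp_def adjacent_def insert_commute)
  then show ?thesis using assms symp_rtranclp sympD by metis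
qed

text \<open>Serves to carry invariants of the label collection, such as its size and its span, from
  one vertex to all others.\<close>

lemma connected_graph_constant:
  assumes "connected_graph G" "p \<in> verts G"
    and "\<And>q r. adjacent G q r \<Longrightarrow> f q = f r"
    and "q \<in> verts G"
  shows "f p = f q"
proof -
  have "(adjacent G)\<^sup>*\<^sup>* p q" using assms by (simp add: connected_graph_def)
  then show ?thesis by induction (use assms(3) in auto)
qed

text \<open>Reachability is reflexive, so \<open>p\<close> is always a vertex here; this is why
  \<open>subgraph_component\<close> asks for \<open>p\<close> to lie in \<open>G\<close>.\<close>

definition component :: "('v, 'e) multigraph \<Rightarrow> 'v \<Rightarrow> ('v, 'e) multigraph" where
  "component G p =
     (let V = {q. (adjacent G)\<^sup>*\<^sup>* p q}
      in \<lparr>verts = V, edges = {e \<in> edges G. ends G e \<subseteq> V}, ends = ends G\<rparr>)"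

lemma verts_component [simp]: "verts (component G p) = {q. (adjacent G)\<^sup>*\<^sup>* p q}"
  and edges_component [simp]:
    "edges (component G p) = {e \<in> edges G. ends G e \<subseteq> {q. (adjacent G)\<^sup>*\<^sup>* p q}}"
  and ends_component [simp]: "ends (component G p) = ends G"
  by (simp_all add: component_def Let_def)

text \<open>An edge at a reachable vertex ends at a reachable vertex, so no edge is cut off and
  valencies and labels can be read in \<open>G\<close>.\<close>

lemma edges_at_component:
  assumes "finite_loopless_graph G" "q \<in> verts (component G p)"
  shows "edges_at (component G p) q = edges_at G q"
proof
  show "edges_at (component G p) q \<subseteq> edges_at G q"
    by (auto simp: edges_at_def)
  show "edges_at G q \<subseteq> edges_at (component G p) q"
  proof
    fix e assume e: "e \<in> edges_at G q"
    then obtain r where r: "ends G e = {q, r}"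
      using ends_eq_doubleton[OF assms(1)] by metis
    have "adjacent G q r" using e r by (auto simp: adjacent_def edges_at_def)
    then have "(adjacent G)\<^sup>*\<^sup>* p r" using assms(2) by auto
    then show "e \<in> edges_at (component G p) q"
      using e r assms(2) by (auto simp: edges_at_def)
  qed
qed

lemma adjacent_in_verts:
  "finite_loopless_graph G \<Longrightarrow> adjacent G p q \<Longrightarrow> p \<in> verts G \<and> q \<in> verts G"
  unfolding finite_loopless_graph_def adjacent_def by (metis insert_subset)

lemma reachable_in_verts:
  assumes "(adjacent G)\<^sup>*\<^sup>* p q" "finite_loopless_graph G" "p \<in> verts G"
  shows "q \<in> verts G"
  using assms by (induction rule: rtranclp_induct) (auto dest: adjacent_in_verts)

lemma subgraph_component:
  assumes "finite_loopless_graph G" "p \<in> verts G"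
  shows "subgraph (component G p) G"
  using assms reachable_in_verts unfolding subgraph_def by fastforce

lemma connected_component:
  assumes "finite_loopless_graph G"
  shows "connected_graph (component G p)"
proof -
  \<comment> \<open>A path of \<open>G\<close> from \<open>p\<close> stays in the component, since
    every vertex on it is itself reachable from \<open>p\<close>.\<close>
  have reach: "(adjacent (component G p))\<^sup>*\<^sup>* p q" if "(adjacent G)\<^sup>*\<^sup>* p q" for q
    using that
  proof (induction rule: rtranclp_induct)
    case (step q r)
    have pr: "(adjacent G)\<^sup>*\<^sup>* p r" using step.hyps by auto
    obtain e where "e \<in> edges G" "ends G e = {q, r}"
      using step.hyps(2) by (auto simp: adjacent_def)
    then have "adjacent (component G p) q r"
      unfolding adjacent_def using step.hyps(1) pr by auto
    then show ?case using step.IH by auto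
  qed auto
  show ?thesis
    unfolding connected_graph_def
    using reach adjacent_reachable_sym[OF reach] by (auto intro: rtranclp_trans)
qed

lemma is_disjoint_union_components:
  assumes "finite_loopless_graph G"
  shows "is_disjoint_union G (component G ` verts G)"
proof -
  have edge: "\<exists>p\<in>verts G. e \<in> edges (component G p)" if e: "e \<in> edges G" for e
  proof -
    have "ends G e \<subseteq> verts G" "ends G e \<noteq> {}"
      using assms e by (auto simp: finite_loopless_graph_def)
    then obtain p where p: "p \<in> verts G" "e \<in> edges_at G p"
      using e by (auto simp: edges_at_def)
    then have "e \<in> edges_at (component G p) p"
      using edges_at_component[OF assms] by simp
    then show ?thesis using p(1) by (auto simp: edges_at_def)
  qed
  have same: "component G p = component G q"
    if "r \<in> verts (component G p)" "r \<in> verts (component G q)" for p q r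
  proof -
    have "(adjacent G)\<^sup>*\<^sup>* p q" "(adjacent G)\<^sup>*\<^sup>* q p"
      using that adjacent_reachable_sym[of G p r] adjacent_reachable_sym[of G q r]
      by (auto intro: rtranclp_trans)
    then have "{x. (adjacent G)\<^sup>*\<^sup>* p x} = {x. (adjacent G)\<^sup>*\<^sup>* q x}"
      by (auto intro: rtranclp_trans)
    then show ?thesis by (simp add: component_def)
  qed
  have verts_disj: "verts (component G p) \<inter> verts (component G q) = {}"
    if "component G p \<noteq> component G q" for p q
    using same that by blast
  have edges_disj: "edges (component G p) \<inter> edges (component G q) = {}"
    if "component G p \<noteq> component G q" for p q
  proof -
    \<comment> \<open>An edge without endpoints would lie in every component, so disjointness of
      vertices alone would not separate the edges.\<close>
    have "ends G e \<noteq> {}" if "e \<in> edges G" for e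
      using assms that by (auto simp: finite_loopless_graph_def)
    then show ?thesis using verts_disj[OF that] by fastforce
  qed
  show ?thesis
    unfolding is_disjoint_union_def
  proof (intro conjI)
    show "verts G = (\<Union>H\<in>component G ` verts G. verts H)"
      using reachable_in_verts[OF _ assms] by auto
    show "edges G = (\<Union>H\<in>component G ` verts G. edges H)"
      using edge by fastforce
  qed (use verts_disj edges_disj in blast)
qed

section \<open>Faces cut out by label subspaces, and their intersections\<close>

lemma l_independent_le:
  assumes "l_independent l \<Gamma> \<alpha>" "p \<in> verts \<Gamma>" "finite (edges_at \<Gamma> p)"
    and "l \<le> card (edges_at \<Gamma> p)" "T \<subseteq> edges_at \<Gamma> p" "card T \<le> l"
  shows "inj_on \<alpha> T \<and> bitfun.independent (\<alpha> ` T)"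
proof -
  \<comment> \<open>\<open>l_independent\<close> speaks only of sets of exactly \<open>l\<close>
    edges, so \<open>T\<close> is first enlarged to that size; the valency leaves room for
    this.\<close>
  obtain S where "T \<subseteq> S" "S \<subseteq> edges_at \<Gamma> p" "card S = l"
    using exists_subset_between[of T l "edges_at \<Gamma> p"] assms by auto
  then have "inj_on \<alpha> S" "bitfun.independent (\<alpha> ` S)"
    using assms(1,2) unfolding l_independent_def by blast+
  then show ?thesis
    using \<open>T \<subseteq> S\<close> by (meson bitfun.independent_mono image_mono inj_on_subset)
qed

text \<open>As \<open>d < l\<close>, the \<open>d\<close> edges of \<open>H\<close> at
  \<open>p\<close> and one further edge \<open>e\<close> still number at most \<open>l\<close>, so
  their labels are independent. The label of \<open>e\<close> then lies outside the span
  \<open>K\<close> of the others.\<close>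

lemma is_face_edges_at:
  assumes face: "is_face \<Gamma> \<alpha> d H" and fin: "finite_loopless_graph \<Gamma>"
    and ind: "l_independent l \<Gamma> \<alpha>" and "d < l"
    and val: "\<And>p. p \<in> verts \<Gamma> \<Longrightarrow> l \<le> card (edges_at \<Gamma> p)"
  obtains K where "bitfun.subspace K" "K \<subseteq> Hom_Z2"
    "\<And>p. p \<in> verts H \<Longrightarrow> edges_at H p = {e \<in> edges_at \<Gamma> p. \<alpha> e \<in> K}"
proof -
  have sub: "subgraph H \<Gamma>" and reg: "regular d H"
    using face by (auto simp: is_face_def)
  obtain K where K: "bitfun.subspace K" "K \<subseteq> Hom_Z2"
    and span: "\<And>p. p \<in> verts H \<Longrightarrow> bitfun.span (set_mset (labels_at \<alpha> H p)) = K"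
    using face by (auto simp: is_face_def)
  have "edges_at H p = {e \<in> edges_at \<Gamma> p. \<alpha> e \<in> K}" if p: "p \<in> verts H" for p
  proof -
    let ?T = "edges_at H p"
    have pG: "p \<in> verts \<Gamma>" and TE: "?T \<subseteq> edges_at \<Gamma> p"
      using sub p subgraph_edges_at_subset[OF sub] by (auto simp: subgraph_def)
    have finT: "finite ?T" using TE finite_edges_at[OF fin] finite_subset by blast
    have cardT: "card ?T = d" using reg p by (simp add: regular_def)
    have spanT: "bitfun.span (\<alpha> ` ?T) = K"
      using span[OF p] finT by (simp add: labels_at_def)
    have "e \<in> ?T" if e: "e \<in> edges_at \<Gamma> p" "\<alpha> e \<in> K" for e
    proof (rule ccontr)
      assume "e \<notin> ?T"
      then have "card (insert e ?T) \<le> l" using finT cardT \<open>d < l\<close> by simp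
      then have *: "inj_on \<alpha> (insert e ?T)" "bitfun.independent (\<alpha> ` insert e ?T)"
        using l_independent_le[OF ind pG finite_edges_at[OF fin] val[OF pG],
            of "insert e ?T"] TE e(1) by blast+
      \<comment> \<open>Independence of the image set cannot detect a repeated label; injectivity
        rules out that \<open>e\<close> shares its label with an edge of \<open>H\<close>.\<close>
      have "\<alpha> e \<notin> \<alpha> ` ?T" using *(1) \<open>e \<notin> ?T\<close> by (auto simp: inj_on_def)
      then have "\<alpha> e \<notin> bitfun.span (\<alpha> ` ?T)"
        using *(2) by (simp add: bitfun.independent_insert)
      then show False using e(2) spanT by simp
    qed
    moreover have "\<alpha> e \<in> K" if "e \<in> ?T" for e
      using that spanT bitfun.span_base by blast
    ultimately show ?thesis using TE by blast
  qed
  then show ?thesis using that K by blast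
qed

text \<open>A converse to \<open>is_face_edges_at\<close>. Here \<open>K\<close> merely selects the
  edges and is not assumed to be spanned by their labels, as is appropriate for an intersection of
  label spaces.\<close>

lemma connected_subspace_subgraph_is_face:
  assumes fin: "finite_loopless_graph \<Gamma>" and cong: "congruent_along_edges \<Gamma> \<alpha>"
    and sub: "subgraph H \<Gamma>" and conn: "connected_graph H" and p: "p \<in> verts H"
    and K: "bitfun.subspace K" "K \<subseteq> Hom_Z2"
    and edges: "\<And>q. q \<in> verts H \<Longrightarrow> edges_at H q = {e \<in> edges_at \<Gamma> q. \<alpha> e \<in> K}"
  shows "is_face \<Gamma> \<alpha> (card (edges_at H p)) H"
proof -
  have finH: "finite_loopless_graph H" using finite_loopless_subgraph[OF sub fin] .
  have labels: "labels_at \<alpha> H q = filter_mset (\<lambda>x. x \<in> K) (labels_at \<alpha> \<Gamma> q)"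
    if "q \<in> verts H" for q
    using edges[OF that] finite_edges_at[OF fin]
    by (simp add: labels_at_def filter_mset_image_mset filter_mset_mset_set)
  have congH: "cong_modulo (labels_at \<alpha> H q) (labels_at \<alpha> H r) (\<alpha> e)"
    and mem: "\<alpha> e \<in># labels_at \<alpha> H q" "\<alpha> e \<in># labels_at \<alpha> H r"
    if e: "e \<in> edges H" "ends H e = {q, r}" for e q r
  proof -
    have qr: "q \<in> verts H" "r \<in> verts H" "e \<in> edges \<Gamma>" "ends \<Gamma> e = {q, r}"
      using e sub by (auto simp: subgraph_def)
    have eqr: "e \<in> edges_at H q" "e \<in> edges_at H r" using e by (auto simp: edges_at_def)
    then have "\<alpha> e \<in> K" using edges[OF qr(1)] by blast
    moreover have "cong_modulo (labels_at \<alpha> \<Gamma> q) (labels_at \<alpha> \<Gamma> r) (\<alpha> e)"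
      using cong qr by (auto simp: congruent_along_edges_def)
    ultimately show "cong_modulo (labels_at \<alpha> H q) (labels_at \<alpha> H r) (\<alpha> e)"
      using cong_modulo_filter_subspace K(1) by (simp add: labels qr)
    show "\<alpha> e \<in># labels_at \<alpha> H q" "\<alpha> e \<in># labels_at \<alpha> H r"
      using eqr by (auto simp: set_labels_at[OF finH])
  qed
  \<comment> \<open>Stated for a general invariant \<open>f\<close> so that it serves twice: with
    \<open>size\<close> it gives the valency, with the span the label space.\<close>
  have const: "f (labels_at \<alpha> H p) = f (labels_at \<alpha> H q)"
    if "q \<in> verts H"
      and f: "\<And>A B v. cong_modulo A B v \<Longrightarrow> v \<in># A \<Longrightarrow> v \<in># B \<Longrightarrow> f A = f B"
    for q and f :: "(bit ^ 'c \<Rightarrow> bit) multiset \<Rightarrow> 'd"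
  proof (rule connected_graph_constant[OF conn p _ that(1), where f = "\<lambda>q. f (labels_at \<alpha> H q)"])
    fix q r assume "adjacent H q r"
    then obtain e where "e \<in> edges H" "ends H e = {q, r}" by (auto simp: adjacent_def)
    then show "f (labels_at \<alpha> H q) = f (labels_at \<alpha> H r)" using f congH mem by metis
  qed
  \<comment> \<open>The subspace witnessing that \<open>H\<close> is a face is the actual span of
    the labels at \<open>p\<close>, which may be smaller than \<open>K\<close>.\<close>
  let ?L = "bitfun.span (set_mset (labels_at \<alpha> H p))"
  have "card (edges_at H q) = card (edges_at H p)" if "q \<in> verts H" for q
    using const[OF that, of size] cong_modulo_size_eq by (fastforce simp: labels_at_def)
  then have "regular (card (edges_at H p)) H" by (simp add: regular_def)
  moreover have "bitfun.span (set_mset (labels_at \<alpha> H q)) = ?L" if "q \<in> verts H" for q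
    using const[OF that, of "\<lambda>A. bitfun.span (set_mset A)"] cong_modulo_span_eq by blast
  moreover have "?L \<subseteq> Hom_Z2"
  proof -
    have "?L \<subseteq> K" using K(1) labels[OF p] by (intro bitfun.span_minimal) auto
    then show ?thesis using K(2) by blast
  qed
  moreover have "congruent_along_edges H \<alpha>"
    using congH by (auto simp: congruent_along_edges_def)
  ultimately show ?thesis
    unfolding is_face_def using sub conn bitfun.subspace_span by blast
qed

text \<open>Equal valency forces \<open>H\<close> to contain all edges of \<open>F\<close> at each
  of its vertices. Hence \<open>H\<close> is closed under adjacency in \<open>F\<close>, and
  connectedness of \<open>F\<close> does the rest.\<close>

lemma subgraph_of_connected_regular_eq:
  fixes H F :: "('v, 'e) multigraph"
  assumes fin: "finite_loopless_graph F" and conn: "connected_graph F"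
    and reg: "regular d F" "regular d H" and sub: "subgraph H F" and p: "p \<in> verts H"
  shows "H = F"
proof -
  have VHF: "verts H \<subseteq> verts F" and ends: "ends H = ends F"
    and closed: "\<And>e. e \<in> edges H \<Longrightarrow> ends F e \<subseteq> verts H"
    using sub by (metis subgraph_def)+
  have at: "edges_at H q = edges_at F q" if "q \<in> verts H" for q
  proof (rule card_subset_eq[OF finite_edges_at[OF fin] subgraph_edges_at_subset[OF sub]])
    show "card (edges_at H q) = card (edges_at F q)"
      using that VHF reg by (auto simp: regular_def)
  qed
  have "q \<in> verts H" if "(adjacent F)\<^sup>*\<^sup>* p q" for q
    using that
  proof (induction rule: rtranclp_induct)
    case (step q r)
    then obtain e where e: "e \<in> edges F" "ends F e = {q, r}" by (auto simp: adjacent_def)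
    then have "e \<in> edges_at H q" using at[OF step.IH] by (auto simp: edges_at_def)
    then show ?case using closed e(2) by (auto simp: edges_at_def)
  qed (rule p)
  then have V: "verts H = verts F" using conn VHF p by (auto simp: connected_graph_def)
  have "e \<in> edges H" if e: "e \<in> edges F" for e
  proof -
    have "ends F e \<subseteq> verts F" "ends F e \<noteq> {}"
      using fin e by (auto simp: finite_loopless_graph_def)
    then obtain q where "q \<in> verts H" "e \<in> edges_at F q"
      using e V by (auto simp: edges_at_def)
    then show ?thesis using at by (auto simp: edges_at_def)
  qed
  then have "edges H = edges F" using sub by (auto simp: subgraph_def)
  then show ?thesis using V ends by simp
qed

text \<open>A strict drop below every \<open>m i\<close> cannot be expected: one face may be
  contained in all the others, or all may coincide. So the drop below \<open>m i\<close> may fail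
  only when the component is \<open>F i\<close> itself, and two distinct faces force a drop below at
  least one of the dimensions.\<close>

theorem proposition3p2:
  fixes \<Gamma> :: "('v, 'e) multigraph"
    and \<alpha> :: "'e \<Rightarrow> bit ^ 'k \<Rightarrow> bit"
    and n l s :: nat
    and m :: "nat \<Rightarrow> nat"
    and F :: "nat \<Rightarrow> ('v, 'e) multigraph"
  assumes "abstract_1_skeleton n \<Gamma> \<alpha>"
    and "l_independent l \<Gamma> \<alpha>"
    and "l \<le> CARD('k)"
    and "s > 1"
    and "\<And>i. i \<in> {1..s} \<Longrightarrow> is_face \<Gamma> \<alpha> (m i) (F i)"
    and "\<And>i. i \<in> {1..s} \<Longrightarrow> m i < l"
  shows "verts (inter_graph \<Gamma> {1..s} F) = {} \<or>
    (\<exists>\<H>. is_disjoint_union (inter_graph \<Gamma> {1..s} F) \<H> \<and>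
      (\<forall>H\<in>\<H>. \<exists>d. is_face \<Gamma> \<alpha> d H \<and>
        (\<forall>i\<in>{1..s}. d < m i \<or> H = F i) \<and>
        ((\<exists>i\<in>{1..s}. \<exists>j\<in>{1..s}. F i \<noteq> F j) \<longrightarrow> (\<exists>i\<in>{1..s}. d < m i))))"
proof -
  let ?I = "{1..s}"
  let ?G = "inter_graph \<Gamma> ?I F"
  have fin: "finite_loopless_graph \<Gamma>" and cong: "congruent_along_edges \<Gamma> \<alpha>"
    and val: "\<And>p. p \<in> verts \<Gamma> \<Longrightarrow> l \<le> card (edges_at \<Gamma> p)"
    using assms(1,3) by (auto simp: abstract_1_skeleton_def regular_def)
  have subF: "subgraph (F i) \<Gamma>" and connF: "connected_graph (F i)" and regF: "regular (m i) (F i)"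
    if "i \<in> ?I" for i
    using assms(5)[OF that] by (auto simp: is_face_def)
  have "?I \<noteq> {}" using assms(4) by auto
  have subG: "subgraph ?G \<Gamma>" using subgraph_inter_graph[OF subF \<open>?I \<noteq> {}\<close>] .
  have finG: "finite_loopless_graph ?G" using finite_loopless_subgraph[OF subG fin] .
  have "\<forall>i\<in>?I. \<exists>K. bitfun.subspace K \<and> K \<subseteq> Hom_Z2 \<and>
      (\<forall>p\<in>verts (F i). edges_at (F i) p = {e \<in> edges_at \<Gamma> p. \<alpha> e \<in> K})"
  proof
    fix i assume "i \<in> ?I"
    then show "\<exists>K. bitfun.subspace K \<and> K \<subseteq> Hom_Z2 \<and>
        (\<forall>p\<in>verts (F i). edges_at (F i) p = {e \<in> edges_at \<Gamma> p. \<alpha> e \<in> K})"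
      using is_face_edges_at[OF assms(5) fin assms(2) assms(6) val] by metis
  qed
  then have "\<exists>K. \<forall>i\<in>?I. bitfun.subspace (K i) \<and> K i \<subseteq> Hom_Z2 \<and>
      (\<forall>p\<in>verts (F i). edges_at (F i) p = {e \<in> edges_at \<Gamma> p. \<alpha> e \<in> K i})"
    by (rule bchoice)
  then obtain K where K: "\<And>i. i \<in> ?I \<Longrightarrow> bitfun.subspace (K i)" "\<And>i. i \<in> ?I \<Longrightarrow> K i \<subseteq> Hom_Z2"
    and edgesF: "\<And>i p. i \<in> ?I \<Longrightarrow> p \<in> verts (F i) \<Longrightarrow>
        edges_at (F i) p = {e \<in> edges_at \<Gamma> p. \<alpha> e \<in> K i}"
    by blast
  define L where "L = (\<Inter>i\<in>?I. K i)"
  have L: "bitfun.subspace L" "L \<subseteq> Hom_Z2"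
  proof -
    show "bitfun.subspace L" unfolding L_def using K(1) by (intro bitfun.subspace_Inter) blast
    show "L \<subseteq> Hom_Z2" unfolding L_def using K(2) \<open>?I \<noteq> {}\<close> by blast
  qed
  have edgesG: "edges_at ?G p = {e \<in> edges_at \<Gamma> p. \<alpha> e \<in> L}" if "p \<in> verts ?G" for p
  proof -
    have "p \<in> verts (F i)" if "i \<in> ?I" for i
      using \<open>p \<in> verts ?G\<close> that by (simp add: inter_graph_def)
    then have "edges_at ?G p = (\<Inter>i\<in>?I. {e \<in> edges_at \<Gamma> p. \<alpha> e \<in> K i})"
      using edges_at_inter_graph[OF subF \<open>?I \<noteq> {}\<close>] edgesF by simp
    then show ?thesis using \<open>?I \<noteq> {}\<close> by (auto simp: L_def)
  qed
  have "\<exists>d. is_face \<Gamma> \<alpha> d H \<and> (\<forall>i\<in>?I. d < m i \<or> H = F i) \<and>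
      ((\<exists>i\<in>?I. \<exists>j\<in>?I. F i \<noteq> F j) \<longrightarrow> (\<exists>i\<in>?I. d < m i))"
    if mem: "H \<in> component ?G ` verts ?G" for H
  proof -
    obtain p where p: "p \<in> verts ?G" and H: "H = component ?G p" using mem by blast
    have subHG: "subgraph H ?G" unfolding H using subgraph_component[OF finG p] .
    have pH: "p \<in> verts H" by (simp add: H)
    let ?d = "card (edges_at H p)"
    have edgesH: "edges_at H q = {e \<in> edges_at \<Gamma> q. \<alpha> e \<in> L}" if "q \<in> verts H" for q
    proof -
      have "q \<in> verts ?G" using subHG that by (auto simp: subgraph_def)
      then show ?thesis using edges_at_component[OF finG] edgesG that by (simp add: H)
    qed
    have face: "is_face \<Gamma> \<alpha> ?d H"
      using connected_subspace_subgraph_is_face[OF fin cong subgraph_trans[OF subHG subG] _ pH L edgesH]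
        connected_component[OF finG] by (simp add: H)
    have dim: "?d < m i \<or> H = F i" if i: "i \<in> ?I" for i
    proof -
      have finF: "finite_loopless_graph (F i)" using finite_loopless_subgraph[OF subF[OF i] fin] .
      have "subgraph ?G (F i)"
        using subG subF[OF i] i by (auto simp: subgraph_def inter_graph_def)
      then have subHF: "subgraph H (F i)" using subHG subgraph_trans by blast
      then have "p \<in> verts (F i)" using pH by (auto simp: subgraph_def)
      then have "?d \<le> m i"
        using card_mono[OF finite_edges_at[OF finF] subgraph_edges_at_subset[OF subHF], of p]
          regF[OF i] by (simp add: regular_def)
      moreover have "H = F i" if "?d = m i"
        using subgraph_of_connected_regular_eq[OF finF connF[OF i] regF[OF i] _ subHF pH] face that
        by (simp add: is_face_def)
      ultimately show ?thesis by linarith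
    qed
    \<comment> \<open>If \<open>F i\<close> and \<open>F j\<close> differ, then \<open>H\<close>
      cannot equal both, so the dimension drops below \<open>m i\<close> or
      \<open>m j\<close>.\<close>
    then show ?thesis using face by metis
  qed
  then show ?thesis using is_disjoint_union_components[OF finG] by blast
qed

end
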